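(* Let $A$ be a formula of classical propositional logic built from literals using $\wedge$ and $\vee$. Then $A$ is valid (true under every truth assignment to its variables) if and only if $A$ has a combinatorial proof, i.e. there exist a formula $A'$ (built from literals using $\wedge$ and $\vee$), an MLL proof net on $A'$, and a label- and clique-preserving function from the leaves of $A'$ to the leaves of $A$.
   Context: Formulas are built from literals (propositional variables $P,Q,\ldots$ and their negations $\overline{P},\overline{Q},\ldots$) using binary $\wedge$ and $\vee$; implication is treated as an abbreviation, $X\Rightarrow Y$ meaning $\overline{X}\vee Y$ with negation pushed to the literals by De Morgan's laws. A formula is identified with its parse tree: a tree whose leaves are labelled by literals and whose internal vertices are labelled $\wedge$ or $\vee$; distinct occurrences of the same literal are distinct leaves. A $\vee$-resolution of a formula $A$ is any result of deleting, at each $\vee$-vertex of the parse tree, one of its two argument subtrees. A set $L$ of leaves of $A$ is a clique of $A$ if $L$ is the set of leaves of some $\vee$-resolution of $A$. A function $f$ from the leaves of $A'$ to the leaves of $A$ is label-preserving if each leaf and its image carry the same literal, and clique-preserving if the image under $f$ of every clique of $A'$ is a clique of $A$. An MLL proof net on $A'$ is obtained by reading $A'$ as a formula of multiplicative linear logic ($\wedge$ as tensor, $\vee$ as par) and giving a set of axiom links, i.e. a partition of the leaves of $A'$ into pairs each consisting of a leaf labelled $P$ and a leaf labelled $\overline{P}$ for some variable $P$, such that the standard (Danos–Regnier) correctness criterion holds: for every switching (choosing, at each $\vee$-vertex, exactly one of the two edges to its arguments, and keeping all edges at $\wedge$-vertices), the undirected graph formed by the parse tree edges so chosen together with the axiom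 links is connected and acyclic. *)

theory Defs
  imports Main "HOL-Library.Sublist" "HOL-Library.Disjoint_Sets" "HOL-Library.FuncSet"
begin

datatype 'v literal = Pos 'v | Neg 'v

datatype 'v form = Lit "'v literal" | And "'v form" "'v form" | Or "'v form" "'v form"

fun lit_true :: "('v \<Rightarrow> bool) \<Rightarrow> 'v literal \<Rightarrow> bool" where
  "lit_true \<nu> (Pos P) = \<nu> P"
| "lit_true \<nu> (Neg P) = (\<not> \<nu> P)"

fun form_true :: "('v \<Rightarrow> bool) \<Rightarrow> 'v form \<Rightarrow> bool" where
  "form_true \<nu> (Lit l) = lit_true \<nu> l"
| "form_true \<nu> (And A B) = (form_true \<nu> A \<and> form_true \<nu> B)"
| "form_true \<nu> (Or A B) = (form_true \<nu> A \<or> form_true \<nu> B)"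

definition valid :: "'v form \<Rightarrow> bool" where
  "valid A \<longleftrightarrow> (\<forall>\<nu>. form_true \<nu> A)"

text \<open>
  A vertex of the parse tree is represented by its address, the list of directions on the path
  from the root (the empty list) to it. Thus distinct occurrences of a literal are distinct leaves,
  the arguments of an internal vertex \<open>v\<close> are \<open>v @ [Lft]\<close> and \<open>v @ [Rgt]\<close>, and the subtree
  rooted at \<open>v\<close> consists of the vertices that extend \<open>v\<close>.
\<close>

datatype dir = Lft | Rgt

type_synonym pos = "dir list"

fun subform_at :: "'v form \<Rightarrow> pos \<Rightarrow> 'v form option" where
  "subform_at A [] = Some A"
| "subform_at (Lit l) (d # p) = None"
| "subform_at (And A B) (d # p) = subform_at (case d of Lft \<Rightarrow> A | Rgt \<Rightarrow> B) p"
| "subform_at (Or A B) (d # p) = subform_at (case d of Lft \<Rightarrow> A | Rgt \<Rightarrow> B) p"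

definition vertices :: "'v form \<Rightarrow> pos set" where
  "vertices A = {v. subform_at A v \<noteq> None}"

definition leaf_label :: "'v form \<Rightarrow> pos \<Rightarrow> 'v literal \<Rightarrow> bool" where
  "leaf_label A v l \<longleftrightarrow> subform_at A v = Some (Lit l)"

definition leaves :: "'v form \<Rightarrow> pos set" where
  "leaves A = {v. \<exists>l. leaf_label A v l}"

definition and_vertices :: "'v form \<Rightarrow> pos set" where
  "and_vertices A = {v. \<exists>B C. subform_at A v = Some (And B C)}"

definition or_vertices :: "'v form \<Rightarrow> pos set" where
  "or_vertices A = {v. \<exists>B C. subform_at A v = Some (Or B C)}"

text \<open>
  A choice at each disjunction vertex is given by a total function on addresses; only its values
  at the disjunction vertices matter. In a resolution, \<open>\<delta> v\<close> is the argument of \<open>v\<close> that is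
  deleted; the resolution is represented by the set of vertices that survive all the deletions.
\<close>

definition or_resolution :: "'v form \<Rightarrow> (pos \<Rightarrow> dir) \<Rightarrow> pos set" where
  "or_resolution A \<delta> = {u \<in> vertices A. \<forall>v \<in> or_vertices A. \<not> prefix (v @ [\<delta> v]) u}"

definition clique :: "'v form \<Rightarrow> pos set \<Rightarrow> bool" where
  "clique A K \<longleftrightarrow> (\<exists>\<delta>. K = leaves A \<inter> or_resolution A \<delta>)"

definition label_preserving :: "'v form \<Rightarrow> 'v form \<Rightarrow> (pos \<Rightarrow> pos) \<Rightarrow> bool" where
  "label_preserving A' A f \<longleftrightarrow>
     (\<forall>v \<in> leaves A'. \<forall>l. leaf_label A' v l \<longleftrightarrow> leaf_label A (f v) l)"

definition clique_preserving :: "'v form \<Rightarrow> 'v form \<Rightarrow> (pos \<Rightarrow> pos) \<Rightarrow> bool" where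
  "clique_preserving A' A f \<longleftrightarrow> (\<forall>K. clique A' K \<longrightarrow> clique A (f ` K))"

text \<open>
  Finite simple undirected graphs, with an edge set of two-element sets of vertices.
\<close>

definition graph_connected :: "'a set \<Rightarrow> 'a set set \<Rightarrow> bool" where
  "graph_connected V E \<longleftrightarrow> (\<forall>u \<in> V. \<forall>v \<in> V. (u, v) \<in> {(x, y). {x, y} \<in> E}\<^sup>*)"

definition graph_cycle :: "'a set set \<Rightarrow> 'a list \<Rightarrow> bool" where
  "graph_cycle E xs \<longleftrightarrow>
     3 \<le> length xs \<and> distinct xs \<and>
     successively (\<lambda>x y. {x, y} \<in> E) xs \<and> {last xs, hd xs} \<in> E"

definition graph_acyclic :: "'a set set \<Rightarrow> bool" where
  "graph_acyclic E \<longleftrightarrow> (\<nexists>xs. graph_cycle E xs)"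

definition axiom_links :: "'v form \<Rightarrow> pos set set \<Rightarrow> bool" where
  "axiom_links A \<Lambda> \<longleftrightarrow>
     partition_on (leaves A) \<Lambda> \<and>
     (\<forall>X \<in> \<Lambda>. \<exists>u v P. X = {u, v} \<and> leaf_label A u (Pos P) \<and> leaf_label A v (Neg P))"

text \<open>
  In a switching, \<open>\<sigma> v\<close> is the argument of the disjunction vertex \<open>v\<close> whose edge is kept. An axiom
  link joins two leaves and a tree edge has an internal vertex, so the two kinds of edges never
  coincide and no parallel edges are lost in forming the union.
\<close>

definition switching_edges :: "'v form \<Rightarrow> (pos \<Rightarrow> dir) \<Rightarrow> pos set set" where
  "switching_edges A \<sigma> =
     {{v, v @ [d]} | v d. v \<in> and_vertices A} \<union> {{v, v @ [\<sigma> v]} | v. v \<in> or_vertices A}"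

definition mll_proof_net :: "'v form \<Rightarrow> pos set set \<Rightarrow> bool" where
  "mll_proof_net A \<Lambda> \<longleftrightarrow>
     axiom_links A \<Lambda> \<and>
     (\<forall>\<sigma>. graph_connected (vertices A) (switching_edges A \<sigma> \<union> \<Lambda>) \<and>
          graph_acyclic (switching_edges A \<sigma> \<union> \<Lambda>))"

definition combinatorial_proof ::
    "'v form \<Rightarrow> 'v form \<Rightarrow> pos set set \<Rightarrow> (pos \<Rightarrow> pos) \<Rightarrow> bool" where
  "combinatorial_proof A A' \<Lambda> f \<longleftrightarrow>
     mll_proof_net A' \<Lambda> \<and> f \<in> leaves A' \<rightarrow> leaves A \<and>
     label_preserving A' A f \<and> clique_preserving A' A f"

end

(*
Soundness: a valuation that falsifies a proof net yields a cycle in the graph of one switching, so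
proof nets are valid; and a formula is true iff one of its cliques is, which transports validity
along clique-preserving maps.
Completeness: decompose a valid sequent down to literals. A conjunction combines one cover of each
argument by a tensor, after the copies of an argument have been joined by pars (contraction); a
premise that never uses its argument already covers the conclusion (weakening). The correctness
criterion is preserved since joining two disjoint trees by an edge gives a tree.
*)
theory Submission imports Defs "HOL-Library.Multiset" begin

section \<open>Resolutions by recursion on the formula\<close>

text \<open>Carrying axiom links and the map to \<open>A\<close> through the completeness argument
  would mean renaming addresses at every rule. Both are instead stored in the variables. A variable
  of the constructed formula is a triple \<open>(x, y, n)\<close> that records the two ends of one
  link. Tensors require disjoint variables, so every variable occurs once positively and once
  negatively, and the links can be read off the finished formula. The formula \<open>A\<close> is
  replaced by \<open>address_form A\<close>, where every variable carries the address of its leaf; a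
  literal then determines the leaf to which it is sent, and cliques can be compared as sets of
  literals. Only at the end are the variables collapsed to those of \<open>A\<close>. This may
  destroy linearity but not the graphs, which depend on addresses and links alone.\<close>

lemma subform_at_append:
  "subform_at A (p @ q) = Option.bind (subform_at A p) (\<lambda>B. subform_at B q)"
  by (induction A p rule: subform_at.induct) (auto split: dir.splits)

text \<open>Structural counterpart of \<open>clique\<close>: with the choice function gone,
  properties of cliques can be proved by induction on the formula.\<close>

fun res_cliques :: "'v form \<Rightarrow> pos set set" where
  "res_cliques (Lit l) = {{[]}}"
| "res_cliques (And A B) =
     {Cons Lft ` K \<union> Cons Rgt ` L | K L. K \<in> res_cliques A \<and> L \<in> res_cliques B}"
| "res_cliques (Or A B) =
     (\<lambda>K. Cons Lft ` K) ` res_cliques A \<union> (\<lambda>K. Cons Rgt ` K) ` res_cliques B"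

lemma mem_Cons_image: "(d # p \<in> Cons e ` S) \<longleftrightarrow> d = e \<and> p \<in> S"
  by auto

lemma leaves_simps:
  "leaves (Lit l) = {[]}"
  "leaves (And A B) = Cons Lft ` leaves A \<union> Cons Rgt ` leaves B"
  "leaves (Or A B) = Cons Lft ` leaves A \<union> Cons Rgt ` leaves B"
proof -
  have *: "v \<in> leaves (Lit l) \<longleftrightarrow> v \<in> {[]}"
    "v \<in> leaves (And A B) \<longleftrightarrow> v \<in> Cons Lft ` leaves A \<union> Cons Rgt ` leaves B"
    "v \<in> leaves (Or A B) \<longleftrightarrow> v \<in> Cons Lft ` leaves A \<union> Cons Rgt ` leaves B" for v
    by (cases v; auto simp: leaves_def leaf_label_def mem_Cons_image split: dir.splits)+
  show "leaves (Lit l) = {[]}"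
    "leaves (And A B) = Cons Lft ` leaves A \<union> Cons Rgt ` leaves B"
    "leaves (Or A B) = Cons Lft ` leaves A \<union> Cons Rgt ` leaves B"
    using * by blast+
qed

lemma or_vertices_simps:
  "or_vertices (Lit l) = {}"
  "or_vertices (And A B) = Cons Lft ` or_vertices A \<union> Cons Rgt ` or_vertices B"
  "or_vertices (Or A B) = insert [] (Cons Lft ` or_vertices A \<union> Cons Rgt ` or_vertices B)"
proof -
  have *: "v \<notin> or_vertices (Lit l)"
    "v \<in> or_vertices (And A B) \<longleftrightarrow> v \<in> Cons Lft ` or_vertices A \<union> Cons Rgt ` or_vertices B"
    "v \<in> or_vertices (Or A B)
       \<longleftrightarrow> v \<in> insert [] (Cons Lft ` or_vertices A \<union> Cons Rgt ` or_vertices B)" for v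
    by (cases v; auto simp: or_vertices_def mem_Cons_image split: dir.splits)+
  show "or_vertices (Lit l) = {}"
    "or_vertices (And A B) = Cons Lft ` or_vertices A \<union> Cons Rgt ` or_vertices B"
    "or_vertices (Or A B) = insert [] (Cons Lft ` or_vertices A \<union> Cons Rgt ` or_vertices B)"
    using * by blast+
qed

definition surviving_leaves :: "'v form \<Rightarrow> (pos \<Rightarrow> dir) \<Rightarrow> pos set" where
  "surviving_leaves A \<delta> = {u \<in> leaves A. \<forall>v \<in> or_vertices A. \<not> prefix (v @ [\<delta> v]) u}"

lemma clique_iff_surviving_leaves: "clique A K \<longleftrightarrow> (\<exists>\<delta>. K = surviving_leaves A \<delta>)"
proof -
  have "leaves A \<subseteq> vertices A"
    by (auto simp: leaves_def vertices_def leaf_label_def)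
  then have "leaves A \<inter> or_resolution A \<delta> = surviving_leaves A \<delta>" for \<delta>
    by (auto simp: or_resolution_def surviving_leaves_def)
  then show ?thesis by (simp add: clique_def)
qed

lemma surviving_leaves_simps:
  "surviving_leaves (Lit l) \<delta> = {[]}"
  "surviving_leaves (And A B) \<delta> =
     Cons Lft ` surviving_leaves A (\<delta> \<circ> Cons Lft) \<union> Cons Rgt ` surviving_leaves B (\<delta> \<circ> Cons Rgt)"
  "surviving_leaves (Or A B) \<delta> =
     (case \<delta> [] of Lft \<Rightarrow> Cons Rgt ` surviving_leaves B (\<delta> \<circ> Cons Rgt)
                 | Rgt \<Rightarrow> Cons Lft ` surviving_leaves A (\<delta> \<circ> Cons Lft))"
  by (auto simp: surviving_leaves_def leaves_simps or_vertices_simps mem_Cons_image ball_Un split: dir.splits)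

text \<open>Choices in the two arguments are independent, so two choice functions glue to one; at a
  disjunction, choices inside the deleted argument leave no trace.\<close>

lemma clique_iff_res_cliques: "clique A K \<longleftrightarrow> K \<in> res_cliques A"
proof (induction A arbitrary: K)
  case (Lit l)
  then show ?case by (simp add: clique_iff_surviving_leaves surviving_leaves_simps)
next
  case (And A B)
  have "clique (And A B) K \<longleftrightarrow>
      (\<exists>K1 K2. K = Cons Lft ` K1 \<union> Cons Rgt ` K2 \<and> clique A K1 \<and> clique B K2)"
  proof
    assume "\<exists>K1 K2. K = Cons Lft ` K1 \<union> Cons Rgt ` K2 \<and> clique A K1 \<and> clique B K2"
    then obtain \<delta>1 \<delta>2 where
      "K = Cons Lft ` surviving_leaves A \<delta>1 \<union> Cons Rgt ` surviving_leaves B \<delta>2"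
      by (auto simp: clique_iff_surviving_leaves)
    \<comment> \<open>The first direction of an address selects the argument whose choice function
      answers. The root is a conjunction, so the unspecified \<open>hd []\<close> is
      harmless.\<close>
    then have "K = surviving_leaves (And A B)
        (\<lambda>v. case hd v of Lft \<Rightarrow> \<delta>1 (tl v) | Rgt \<Rightarrow> \<delta>2 (tl v))"
      by (simp add: surviving_leaves_simps o_def)
    then show "clique (And A B) K" by (auto simp: clique_iff_surviving_leaves)
  qed (auto simp: clique_iff_surviving_leaves surviving_leaves_simps)
  then show ?case by (simp add: And)
next
  case (Or A B)
  have "clique (Or A B) K \<longleftrightarrow>
      (\<exists>K1. K = Cons Lft ` K1 \<and> clique A K1) \<or> (\<exists>K2. K = Cons Rgt ` K2 \<and> clique B K2)"
    (is "_ \<longleftrightarrow> ?L \<or> ?R")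
  proof
    assume "?L \<or> ?R"
    then show "clique (Or A B) K"
    proof
      assume ?L
      then obtain \<delta> where "K = Cons Lft ` surviving_leaves A \<delta>"
        by (auto simp: clique_iff_surviving_leaves)
      \<comment> \<open>\<open>\<delta>\<close> names the argument that is deleted, hence
        \<open>Rgt\<close> at the root in order to keep the left one.\<close>
      then have "K = surviving_leaves (Or A B) (\<lambda>v. if v = [] then Rgt else \<delta> (tl v))"
        by (simp add: surviving_leaves_simps o_def)
      then show ?thesis by (auto simp: clique_iff_surviving_leaves)
    next
      assume ?R
      then obtain \<delta> where "K = Cons Rgt ` surviving_leaves B \<delta>"
        by (auto simp: clique_iff_surviving_leaves)
      then have "K = surviving_leaves (Or A B) (\<lambda>v. if v = [] then Lft else \<delta> (tl v))"
        by (simp add: surviving_leaves_simps o_def)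
      then show ?thesis by (auto simp: clique_iff_surviving_leaves)
    qed
  next
    assume "clique (Or A B) K"
    then obtain \<delta> where "K = surviving_leaves (Or A B) \<delta>"
      by (auto simp: clique_iff_surviving_leaves)
    then show "?L \<or> ?R"
      by (cases "\<delta> []") (auto simp: clique_iff_surviving_leaves surviving_leaves_simps)
  qed
  then show ?case by (auto simp: Or)
qed

lemma leaf_label_Cons:
  "leaf_label (And A B) (d # p) = leaf_label (case d of Lft \<Rightarrow> A | Rgt \<Rightarrow> B) p"
  "leaf_label (Or A B) (d # p) = leaf_label (case d of Lft \<Rightarrow> A | Rgt \<Rightarrow> B) p"
  by (auto simp: leaf_label_def fun_eq_iff)

text \<open>Cliques are the terms of the disjunctive normal form: a true disjunction keeps a true
  argument, a true conjunction merges true cliques of both arguments.\<close>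

lemma form_true_iff_true_clique:
  "form_true \<nu> A \<longleftrightarrow> (\<exists>K \<in> res_cliques A. \<forall>u \<in> K. \<exists>l. leaf_label A u l \<and> lit_true \<nu> l)"
proof (induction A)
  case (Lit l)
  then show ?case by (simp add: leaf_label_def)
next
  case (And A B)
  show ?case (is "_ \<longleftrightarrow> ?R")
  proof
    assume "form_true \<nu> (And A B)"
    then obtain K L where
      "K \<in> res_cliques A" "\<forall>u \<in> K. \<exists>l. leaf_label A u l \<and> lit_true \<nu> l"
      "L \<in> res_cliques B" "\<forall>u \<in> L. \<exists>l. leaf_label B u l \<and> lit_true \<nu> l"
      using And by auto
    then show ?R
      by (intro bexI[of _ "Cons Lft ` K \<union> Cons Rgt ` L"]) (auto simp: leaf_label_Cons)
  next
    assume ?R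
    then obtain K L where
      "K \<in> res_cliques A" "L \<in> res_cliques B"
      "\<forall>u \<in> Cons Lft ` K \<union> Cons Rgt ` L. \<exists>l. leaf_label (And A B) u l \<and> lit_true \<nu> l"
      by auto
    then show "form_true \<nu> (And A B)"
      using And by (auto simp: leaf_label_Cons ball_Un)
  qed
next
  case (Or A B)
  show ?case
    by (simp add: Or bex_Un leaf_label_Cons)
qed

section \<open>Trees as graphs\<close>

text \<open>Indices modulo the length turn the closing edge into an ordinary one, so all positions
  of a cycle are treated alike.\<close>

lemma graph_cycle_nth:
  "graph_cycle E xs \<longleftrightarrow> 3 \<le> length xs \<and> distinct xs \<and>
     (\<forall>i < length xs. {xs ! i, xs ! (Suc i mod length xs)} \<in> E)" (is "?L \<longleftrightarrow> ?R")
proof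
  assume L: ?L
  have "{xs ! i, xs ! (Suc i mod length xs)} \<in> E" if "i < length xs" for i
  proof (cases "Suc i < length xs")
    case True
    then show ?thesis using L by (auto simp: graph_cycle_def successively_conv_nth)
  next
    case False
    then have "Suc i = length xs" using that by simp
    then have i: "i = length xs - 1" "Suc i mod length xs = 0" by auto
    have "xs \<noteq> []" using that by auto
    then show ?thesis using L i by (auto simp: graph_cycle_def last_conv_nth hd_conv_nth)
  qed
  then show ?R using L by (auto simp: graph_cycle_def)
next
  assume R: ?R
  then have ne: "xs \<noteq> []" by auto
  have "successively (\<lambda>x y. {x, y} \<in> E) xs"
    unfolding successively_conv_nth
    using R by (metis Suc_lessD mod_less)
  moreover have "{last xs, hd xs} \<in> E"
  proof -
    have "Suc (length xs - 1) mod length xs = 0" using ne by simp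
    moreover have "length xs - 1 < length xs" using ne by simp
    ultimately show ?thesis using R ne by (metis last_conv_nth hd_conv_nth)
  qed
  ultimately show ?L using R by (simp add: graph_cycle_def)
qed

text \<open>Predecessor and successor on the cycle are distinct because it has at least three
  vertices.\<close>

lemma graph_cycle_two_neighbours:
  assumes "graph_cycle E xs" "x \<in> set xs"
  obtains y z where "y \<noteq> z" "{x, y} \<in> E" "{x, z} \<in> E"
proof -
  let ?n = "length xs"
  have n: "3 \<le> ?n" "distinct xs" and e: "\<And>i. i < ?n \<Longrightarrow> {xs ! i, xs ! (Suc i mod ?n)} \<in> E"
    using assms(1) by (auto simp: graph_cycle_nth)
  obtain i where i: "i < ?n" "x = xs ! i" using assms(2) by (metis in_set_conv_nth)
  define j where "j = (if i = 0 then ?n - 1 else i - 1)"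
  have j: "j < ?n" "Suc j mod ?n = i" using i n by (auto simp: j_def)
  have "Suc i mod ?n \<noteq> j" using i n by (auto simp: j_def mod_Suc)
  moreover have "Suc i mod ?n < ?n" using i by (intro mod_less_divisor) auto
  ultimately have "xs ! (Suc i mod ?n) \<noteq> xs ! j" using n j by (simp add: nth_eq_iff_index_eq)
  moreover have "{x, xs ! (Suc i mod ?n)} \<in> E" using e i by simp
  moreover have "{x, xs ! j} \<in> E" using e[OF j(1)] j(2) i(2) by (simp add: insert_commute)
  ultimately show thesis using that by blast
qed

text \<open>Trees grown one vertex at a time, so that connectedness and acyclicity both follow by
  induction. The pendant step is exactly what a disjunction vertex does to a switching
  graph.\<close>

inductive tree_graph :: "'a set \<Rightarrow> 'a set set \<Rightarrow> bool" where
  single: "tree_graph {v} {}"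
| pendant: "tree_graph V E \<Longrightarrow> w \<notin> V \<Longrightarrow> a \<in> V \<Longrightarrow> tree_graph (insert w V) (insert {w, a} E)"

lemma tree_graph_edges: "tree_graph V E \<Longrightarrow> e \<in> E \<Longrightarrow> e \<subseteq> V"
  by (induction rule: tree_graph.induct) auto

lemma tree_graph_connected: "tree_graph V E \<Longrightarrow> graph_connected V E"
proof (induction rule: tree_graph.induct)
  case (single v)
  then show ?case by (simp add: graph_connected_def)
next
  case (pendant V E w a)
  let ?r = "\<lambda>E. {(x, y). {x, y} \<in> E}"
  let ?E = "insert {w, a} E"
  have mono: "(?r E)\<^sup>* \<subseteq> (?r ?E)\<^sup>*" by (rule rtrancl_mono) auto
  have V: "(u, v) \<in> (?r ?E)\<^sup>*" if "u \<in> V" "v \<in> V" for u v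
    using pendant.IH that mono unfolding graph_connected_def by blast
  have wa: "(w, a) \<in> ?r ?E" "(a, w) \<in> ?r ?E" by (auto simp: insert_commute)
  have "(w, v) \<in> (?r ?E)\<^sup>*" "(v, w) \<in> (?r ?E)\<^sup>*" if "v \<in> V" for v
    using V[OF \<open>a \<in> V\<close> that] V[OF that \<open>a \<in> V\<close>] wa
    by (meson converse_rtrancl_into_rtrancl rtrancl.rtrancl_into_rtrancl)+
  then show ?case using V unfolding graph_connected_def by blast
qed

text \<open>A cycle cannot pass through the newest vertex, which has only the neighbour
  \<open>a\<close>, so it would already lie in the smaller tree.\<close>

lemma tree_graph_acyclic: "tree_graph V E \<Longrightarrow> graph_acyclic E"
proof (induction rule: tree_graph.induct)
  case (single v)
  then show ?case by (auto simp: graph_acyclic_def graph_cycle_def)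
next
  case (pendant V E w a)
  show ?case unfolding graph_acyclic_def
  proof
    assume "\<exists>xs. graph_cycle (insert {w, a} E) xs"
    then obtain xs where xs: "graph_cycle (insert {w, a} E) xs" ..
    have "w \<notin> set xs"
    proof
      assume "w \<in> set xs"
      then obtain y z where "y \<noteq> z" "{w, y} \<in> insert {w, a} E" "{w, z} \<in> insert {w, a} E"
        using graph_cycle_two_neighbours[OF xs] by blast
      then show False
        using pendant.hyps tree_graph_edges[OF \<open>tree_graph V E\<close>] by (auto simp: doubleton_eq_iff)
    qed
    then have "{x, y} \<in> E" if "x \<in> set xs" "y \<in> set xs" "{x, y} \<in> insert {w, a} E" for x y
      using that by (auto simp: doubleton_eq_iff)
    moreover have "xs ! (Suc i mod length xs) \<in> set xs" if "i < length xs" for i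
      using that by (intro nth_mem mod_less_divisor) auto
    ultimately have "graph_cycle E xs"
      using xs unfolding graph_cycle_nth by (meson nth_mem)
    then show False using pendant.IH by (auto simp: graph_acyclic_def)
  qed
qed

lemma tree_graph_join:
  assumes "tree_graph V2 E2" "tree_graph V1 E1" "V1 \<inter> V2 = {}" "a \<in> V1" "b \<in> V2"
  shows "tree_graph (V1 \<union> V2) (insert {a, b} (E1 \<union> E2))"
  using assms
proof (induction arbitrary: V1 E1 a b rule: tree_graph.induct)
  case (single v)
  then show ?case using tree_graph.pendant[of V1 E1 v a] by (simp add: insert_commute)
next
  case (pendant V E w c)
  show ?case
  proof (cases "b = w")
    case True
    \<comment> \<open>The edge ends in the newest vertex \<open>w\<close>, so the roles change:
      \<open>w\<close> moves to the first tree as a pendant of \<open>a\<close>, and its old edge to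
      \<open>c\<close> becomes the joining edge.\<close>
    have "tree_graph (insert w V1) (insert {w, a} E1)"
      using pendant.prems by (intro tree_graph.pendant) auto
    then have "tree_graph (insert w V1 \<union> V) (insert {w, c} (insert {w, a} E1 \<union> E))"
      using pendant.prems pendant.hyps by (intro pendant.IH) auto
    then show ?thesis using True by (simp add: insert_commute)
  next
    case False
    then have "tree_graph (V1 \<union> V) (insert {a, b} (E1 \<union> E))"
      using pendant.prems by (intro pendant.IH) auto
    then have "tree_graph (insert w (V1 \<union> V)) (insert {w, c} (insert {a, b} (E1 \<union> E)))"
      using pendant.prems pendant.hyps by (intro tree_graph.pendant) auto
    then show ?thesis by (simp add: insert_commute)
  qed
qed

section \<open>Soundness\<close>

lemma finite_vertices: "finite (vertices A)"
proof (induction A)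
  case (Lit l)
  have "vertices (Lit l) \<subseteq> {[]}"
    by (auto simp: vertices_def elim: subform_at.elims)
  then show ?case by (rule finite_subset) simp
next
  case (And A B)
  have "vertices (And A B) \<subseteq> insert [] (Cons Lft ` vertices A \<union> Cons Rgt ` vertices B)"
  proof
    fix v assume "v \<in> vertices (And A B)"
    then show "v \<in> insert [] (Cons Lft ` vertices A \<union> Cons Rgt ` vertices B)"
      by (cases v) (auto simp: vertices_def mem_Cons_image split: dir.splits)
  qed
  then show ?case by (rule finite_subset) (use And in simp)
next
  case (Or A B)
  have "vertices (Or A B) \<subseteq> insert [] (Cons Lft ` vertices A \<union> Cons Rgt ` vertices B)"
  proof
    fix v assume "v \<in> vertices (Or A B)"
    then show "v \<in> insert [] (Cons Lft ` vertices A \<union> Cons Rgt ` vertices B)"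
      by (cases v) (auto simp: vertices_def mem_Cons_image split: dir.splits)
  qed
  then show ?case by (rule finite_subset) (use Or in simp)
qed

text \<open>By finiteness the orbit of \<open>x\<close> repeats; the stretch between the two
  occurrences of the first repeated value is a cycle of \<open>f\<close>, although \<open>x\<close>
  itself may lie on a tail outside it.\<close>

lemma finite_orbit_cycle:
  assumes "finite V" "x \<in> V" "f \<in> V \<rightarrow> V"
  obtains xs where "xs \<noteq> []" "distinct xs" "set xs \<subseteq> V"
    "\<And>k. k < length xs \<Longrightarrow> f (xs ! k) = xs ! (Suc k mod length xs)"
proof -
  define s where "s n = (f ^^ n) x" for n
  have sV: "s n \<in> V" for n
    using assms(2,3) by (induction n) (auto simp: s_def)
  have "\<not> inj_on s UNIV"
    using assms(1) sV by (meson finite_subset image_subsetI infinite_UNIV_nat finite_imageD)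
  then have ex: "\<exists>j. \<exists>i<j. s i = s j" by (metis inj_onI linorder_neqE_nat)
  define j where "j = (LEAST j. \<exists>i<j. s i = s j)"
  obtain i where i: "i < j" "s i = s j" using LeastI_ex[OF ex] j_def by blast
  have least: "s k \<noteq> s l" if "k < l" "l < j" for k l
    using not_less_Least that unfolding j_def by blast
  define xs where "xs = map s [i..<j]"
  have len: "length xs = j - i" by (simp add: xs_def)
  have nth: "xs ! k = s (i + k)" if "k < j - i" for k using that by (simp add: xs_def)
  have "inj_on s {i..<j}" using least by (intro linorder_inj_onI) auto
  then have "distinct xs" by (simp add: xs_def distinct_map)
  moreover have "f (xs ! k) = xs ! (Suc k mod length xs)" if "k < length xs" for k
  proof (cases "Suc k = length xs")
    case True
    then have "f (xs ! k) = s (Suc (i + k))" using that len nth by (simp add: s_def)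
    also have "Suc (i + k) = j" using True len i by simp
    finally show ?thesis using True nth[of 0] i by simp
  next
    case False
    then show ?thesis using that len nth[of k] nth[of "Suc k"] by (simp add: s_def)
  qed
  ultimately show thesis
    using that[of xs] sV i by (auto simp: xs_def)
qed

lemma subform_at_snoc:
  "subform_at A (v @ [d]) =
     (case subform_at A v of
        Some (And B C) \<Rightarrow> Some (case d of Lft \<Rightarrow> B | Rgt \<Rightarrow> C)
      | Some (Or B C) \<Rightarrow> Some (case d of Lft \<Rightarrow> B | Rgt \<Rightarrow> C)
      | _ \<Rightarrow> None)"
  by (auto simp: subform_at_append split: option.splits form.splits dir.splits)

text \<open>
  Under a falsifying assignment, walk from a true vertex to its parent, from a false internal vertex
  to a false argument, and from a false leaf along its axiom link. A cycle of this walk enters a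
  true disjunction from one argument only and leaves a false one towards one argument only, hence
  it is a cycle of the graph of some switching.
\<close>

lemma mll_proof_net_imp_valid:
  assumes "mll_proof_net A \<Lambda>"
  shows "valid A"
  unfolding valid_def
proof (rule allI, rule ccontr)
  fix \<nu> assume root: "\<not> form_true \<nu> A"
  define T where "T v \<longleftrightarrow> (\<exists>B. subform_at A v = Some B \<and> form_true \<nu> B)" for v
  \<comment> \<open>The partner of \<open>u\<close> along its link. Linked leaves carry dual
    literals, so exactly one of the two is true.\<close>
  define p where "p u = (SOME w. {u, w} \<in> \<Lambda> \<and> w \<in> leaves A \<and> (T w \<longleftrightarrow> \<not> T u))" for u
  \<comment> \<open>The root is false, so \<open>butlast\<close> always meets a nonempty address. At
    a false disjunction both arguments are false, so the walk turns left there.\<close>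
  define step where "step v =
    (if T v then butlast v
     else if v \<in> leaves A then p v
     else if T (v @ [Lft]) then v @ [Rgt] else v @ [Lft])" for v
  have links: "axiom_links A \<Lambda>" using assms by (simp add: mll_proof_net_def)
  have p: "{u, p u} \<in> \<Lambda>" "p u \<in> leaves A" "T (p u) \<longleftrightarrow> \<not> T u" if "u \<in> leaves A" for u
  proof -
    obtain X where "u \<in> X" "X \<in> \<Lambda>"
      using links \<open>u \<in> leaves A\<close> by (auto simp: axiom_links_def partition_on_def)
    moreover then obtain a b P where "X = {a, b}" "leaf_label A a (Pos P)" "leaf_label A b (Neg P)"
      using links by (auto simp: axiom_links_def)
    ultimately have "\<exists>w. {u, w} \<in> \<Lambda> \<and> w \<in> leaves A \<and> (T w \<longleftrightarrow> \<not> T u)"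
      by (auto simp: leaves_def leaf_label_def T_def insert_commute)
    from someI_ex[OF this] show "{u, p u} \<in> \<Lambda>" "p u \<in> leaves A" "T (p u) \<longleftrightarrow> \<not> T u"
      by (auto simp: p_def)
  qed
  have not_T_root: "\<not> T []" using root by (simp add: T_def)
  have up: "v \<in> vertices A" if "v @ [d] \<in> vertices A" for v d
    using that by (auto simp: vertices_def subform_at_append split: bind_splits)
  have T_vertices: "v \<in> vertices A" if "T v" for v
    using that by (auto simp: vertices_def T_def)
  have leaf_vertices: "v \<in> vertices A" if "v \<in> leaves A" for v
    using that by (auto simp: vertices_def leaves_def leaf_label_def)
  have leaf_no_child: "v @ [d] \<notin> vertices A" if "v \<in> leaves A" for v d
    using that by (auto simp: vertices_def leaves_def leaf_label_def subform_at_snoc)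
  have down: "v @ [d] \<in> vertices A" if "v \<in> vertices A" "v \<notin> leaves A" for v d
    using that by (auto simp: vertices_def leaves_def leaf_label_def subform_at_snoc
        split: option.splits form.splits)
  have inner: "v \<in> and_vertices A \<or> v \<in> or_vertices A" if "v \<in> vertices A" "v \<notin> leaves A" for v
    using that
    by (auto simp: vertices_def leaves_def leaf_label_def and_vertices_def or_vertices_def)
      (metis form.exhaust)
  have T_Or: "T v \<longleftrightarrow> T (v @ [Lft]) \<or> T (v @ [Rgt])" if "v \<in> or_vertices A" for v
    using that by (auto simp: or_vertices_def T_def subform_at_snoc)
  have T_And: "T v \<longleftrightarrow> T (v @ [Lft]) \<and> T (v @ [Rgt])" if "v \<in> and_vertices A" for v
    using that by (auto simp: and_vertices_def T_def subform_at_snoc)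
  have T_parent: "T (v @ [d]) \<Longrightarrow> v \<in> vertices A \<and> v \<notin> leaves A" for v d
    using up leaf_no_child T_vertices by blast
  have false_child: "\<not> T (step v)" "step v = v @ [Lft] \<or> step v = v @ [Rgt]"
    if "v \<in> vertices A" "v \<notin> leaves A" "\<not> T v" for v
    using that inner[of v] T_And[of v] T_Or[of v] by (auto simp: step_def)
  have step_T: "step (v @ [d]) = v" if "T (v @ [d])" for v d
    using that by (simp add: step_def)
  have step_leaf: "step v = p v" if "v \<in> leaves A" "\<not> T v" for v
    using that by (simp add: step_def)
  have step_closed: "step \<in> vertices A \<rightarrow> vertices A"
  proof
    fix v assume v: "v \<in> vertices A"
    show "step v \<in> vertices A"
    proof (cases "T v")
      case True
      then obtain w d where "v = w @ [d]" using not_T_root by (metis rev_exhaust)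
      then show ?thesis using True v up step_T by metis
    next
      case False
      then show ?thesis
        using v p(2) leaf_vertices step_leaf down false_child(2)[of v] by (metis (full_types))
    qed
  qed
  \<comment> \<open>A graph cycle needs three vertices, so immediate returns must be excluded: the
    parent of a true vertex leads further up or down to a false argument, a link is followed by a
    step up, and a step down by another one or by a link.\<close>
  have no_loop: "step v \<noteq> v \<and> step (step v) \<noteq> v" if v: "v \<in> vertices A" for v
  proof (cases "T v")
    case True
    then obtain w d where w: "v = w @ [d]" using not_T_root by (metis rev_exhaust)
    have "step w \<noteq> v"
    proof (cases "T w")
      case True
      then have "length (step w) < length v" using w by (simp add: step_def)
      then show ?thesis by auto
    next
      case False
      then show ?thesis using false_child(1)[of w] T_parent[of w d] \<open>T v\<close> w by metis
    qed
    then show ?thesis using True w step_T by auto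
  next
    case F: False
    show ?thesis
    proof (cases "v \<in> leaves A")
      case True
      then have "T (p v)" "p v \<in> leaves A" using F p by auto
      then obtain w d where w: "p v = w @ [d]" using not_T_root by (metis rev_exhaust)
      then have "step (p v) = w" "w \<notin> leaves A"
        using step_T T_parent \<open>T (p v)\<close> by auto
      then show ?thesis using True F step_leaf \<open>T (p v)\<close> by auto
    next
      case False
      note c = false_child[OF v False F]
      show ?thesis
      proof (cases "step v \<in> leaves A")
        case True
        then have "step (step v) \<in> leaves A" using c step_leaf p by simp
        then show ?thesis using c False by auto
      next
        case nl: False
        have "step v \<in> vertices A" using step_closed v by auto
        then show ?thesis using c false_child(2)[OF _ nl c(1)] by auto
      qed
    qed
  qed
  obtain xs where xs: "xs \<noteq> []" "distinct xs" "set xs \<subseteq> vertices A"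
    and nxt: "\<And>k. k < length xs \<Longrightarrow> step (xs ! k) = xs ! (Suc k mod length xs)"
    using finite_orbit_cycle[OF finite_vertices _ step_closed, of "[]"]
    by (auto simp: vertices_def)
  have len: "3 \<le> length xs"
  proof (rule ccontr)
    assume "\<not> 3 \<le> length xs"
    moreover have "0 < length xs" using xs by simp
    ultimately consider "length xs = 1" | "length xs = 2" by linarith
    moreover have "xs ! 0 \<in> vertices A" using xs by (meson length_greater_0_conv nth_mem subsetD)
    ultimately show False
      using nxt[of 0] nxt[of 1] no_loop[of "xs ! 0"] by cases auto
  qed
  \<comment> \<open>On the cycle the walk is a permutation, so two true arguments of one vertex
    cannot both lie on it: both would step to that vertex.\<close>
  have inj: "inj_on step (set xs)"
  proof (rule inj_onI)
    fix x y assume "x \<in> set xs" "y \<in> set xs" and eq: "step x = step y"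
    then obtain k l where kl: "k < length xs" "x = xs ! k" "l < length xs" "y = xs ! l"
      by (auto simp: in_set_conv_nth)
    have "Suc k mod length xs = Suc l mod length xs"
      using eq kl nxt xs by (simp add: nth_eq_iff_index_eq)
    then have "k = l" using kl by (auto simp: mod_Suc split: if_splits)
    then show "x = y" using kl by simp
  qed
  \<comment> \<open>At a true disjunction the switching keeps the argument from which the cycle
    arrives. The default \<open>Lft\<close> agrees with the left turn of the walk at a false
    disjunction.\<close>
  define \<sigma> where "\<sigma> v = (if T v \<and> v @ [Rgt] \<in> set xs \<and> T (v @ [Rgt]) then Rgt
      else Lft)" for v
  have edge: "{v, v @ [d]} \<in> switching_edges A \<sigma>"
    if "v \<in> and_vertices A \<or> v \<in> or_vertices A \<and> d = \<sigma> v" for v d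
    using that unfolding switching_edges_def by blast
  have "{c, step c} \<in> switching_edges A \<sigma> \<union> \<Lambda>" if c: "c \<in> set xs" for c
  proof -
    have cV: "c \<in> vertices A" using c xs by auto
    show ?thesis
    proof (cases "T c")
      case True
      then obtain w d where w: "c = w @ [d]" using not_T_root by (metis rev_exhaust)
      have "step c = w" using True w step_T by simp
      moreover have "d = \<sigma> w" if "w \<in> or_vertices A"
      proof -
        have "T w" using T_Or[OF that] True w by (cases d) auto
        moreover have "\<not> (w @ [Rgt] \<in> set xs \<and> T (w @ [Rgt]))" if "d = Lft"
          using inj_onD[OF inj, of c "w @ [Rgt]"] step_T w c True that by auto
        ultimately show ?thesis using True w c by (cases d) (auto simp: \<sigma>_def)
      qed
      moreover have "w \<in> and_vertices A \<or> w \<in> or_vertices A"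
        using inner T_parent True w by blast
      ultimately show ?thesis
        using w edge[of w d] by (auto simp: insert_commute)
    next
      case F: False
      show ?thesis
      proof (cases "c \<in> leaves A")
        case True
        then show ?thesis using F p step_leaf by simp
      next
        case False
        have "step c = c @ [\<sigma> c]" if "c \<in> or_vertices A"
          using T_Or[OF that] F False by (simp add: step_def \<sigma>_def)
        then show ?thesis
          using inner[OF cV False] false_child(2)[OF cV False F] edge[of c] by (metis UnI1)
      qed
    qed
  qed
  then have "graph_cycle (switching_edges A \<sigma> \<union> \<Lambda>) xs"
    unfolding graph_cycle_nth using len xs(2) nxt by (metis nth_mem)
  then show False using assms by (auto simp: mll_proof_net_def graph_acyclic_def)
qed

lemma combinatorial_proof_imp_valid:
  assumes "combinatorial_proof A A' \<Lambda> f"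
  shows "valid A"
  unfolding valid_def
proof
  fix \<nu>
  have "form_true \<nu> A'"
    using assms mll_proof_net_imp_valid by (auto simp: combinatorial_proof_def valid_def)
  then obtain K where K: "K \<in> res_cliques A'"
    "\<forall>u \<in> K. \<exists>l. leaf_label A' u l \<and> lit_true \<nu> l"
    by (auto simp: form_true_iff_true_clique)
  have "\<forall>u \<in> f ` K. \<exists>l. leaf_label A u l \<and> lit_true \<nu> l"
    using K(2) assms by (auto simp: combinatorial_proof_def label_preserving_def leaves_def) blast
  moreover have "f ` K \<in> res_cliques A"
    using K(1) assms
    by (auto simp: combinatorial_proof_def clique_preserving_def clique_iff_res_cliques)
  ultimately show "form_true \<nu> A" unfolding form_true_iff_true_clique by blast
qed

section \<open>Sequent derivations give proof nets\<close>

text \<open>One-sided sequents of multiplicative linear logic in which every variable has one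
  positive and one negative occurrence. The disjointness premise of \<open>tensor\<close> preserves
  this, so links need no separate record.\<close>

inductive mll :: "'w form multiset \<Rightarrow> bool" where
  ax: "mll {#Lit (Pos x), Lit (Neg x)#}"
| par: "mll (add_mset T (add_mset U M)) \<Longrightarrow> mll (add_mset (Or T U) M)"
| tensor: "mll (add_mset T M) \<Longrightarrow> mll (add_mset U N) \<Longrightarrow>
    (\<Union>B \<in> set_mset (add_mset T M). set_form B) \<inter> (\<Union>B \<in> set_mset (add_mset U N). set_form B) = {} \<Longrightarrow>
    mll (add_mset (And T U) (M + N))"

section \<open>Forests inside one parse tree, with their edges and links\<close>

definition vertices_above :: "'w form \<Rightarrow> pos set \<Rightarrow> pos set" where
  "vertices_above B R = {u \<in> vertices B. \<exists>r \<in> R. prefix r u}"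

definition switching_edges_on :: "'w form \<Rightarrow> (pos \<Rightarrow> dir) \<Rightarrow> pos set \<Rightarrow> pos set set" where
  "switching_edges_on B \<sigma> V =
     {{v, v @ [d]} | v d. v \<in> V \<inter> and_vertices B} \<union> {{v, v @ [\<sigma> v]} | v. v \<in> V \<inter> or_vertices B}"

definition dual_links :: "'w form \<Rightarrow> pos set \<Rightarrow> pos set set" where
  "dual_links B V =
     {{u, v} | u v. \<exists>x. (u \<in> V \<and> leaf_label B u (Pos x)) \<and> (v \<in> V \<and> leaf_label B v (Neg x))}"

text \<open>Every variable occurring in \<open>V\<close> has exactly one leaf of each sign there,
  which is what makes \<open>dual_links\<close> a partition.\<close>

definition linear_on :: "'w form \<Rightarrow> pos set \<Rightarrow> bool" where
  "linear_on B V \<longleftrightarrow> (\<forall>u l. u \<in> V \<and> leaf_label B u l \<longrightarrow>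
     (\<forall>x \<in> set_literal l. (\<exists>!v. v \<in> V \<and> leaf_label B v (Pos x)) \<and>
                          (\<exists>!v. v \<in> V \<and> leaf_label B v (Neg x))))"

definition antichain :: "pos set \<Rightarrow> bool" where
  "antichain R \<longleftrightarrow> (\<forall>r \<in> R. \<forall>s \<in> R. prefix r s \<longrightarrow> r = s)"

lemma leaf_label_set_form:
  "leaf_label B u l \<Longrightarrow> x \<in> set_literal l \<Longrightarrow> prefix r u \<Longrightarrow> subform_at B r = Some C \<Longrightarrow> x \<in> set_form C"
proof -
  have *: "subform_at C q = Some (Lit l) \<Longrightarrow> x \<in> set_literal l \<Longrightarrow> x \<in> set_form C" for q
    by (induction C q rule: subform_at.induct) (auto split: dir.splits)
  assume "leaf_label B u l" "x \<in> set_literal l" "prefix r u" "subform_at B r = Some C"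
  then show ?thesis using * by (auto simp: leaf_label_def prefix_def subform_at_append)
qed

lemma vertices_above_insert:
  "vertices_above B (insert r R) = vertices_above B {r} \<union> vertices_above B R"
  by (auto simp: vertices_above_def)

lemma vertices_above_Un:
  "vertices_above B (R \<union> S) = vertices_above B R \<union> vertices_above B S"
  by (auto simp: vertices_above_def)

lemma vertices_above_binary:
  assumes "subform_at B v = Some (And C D) \<or> subform_at B v = Some (Or C D)"
  shows "vertices_above B {v} = insert v (vertices_above B {v @ [Lft]} \<union> vertices_above B {v @ [Rgt]})"
proof -
  have "prefix v u \<longleftrightarrow> u = v \<or> prefix (v @ [Lft]) u \<or> prefix (v @ [Rgt]) u" for u
  proof
    assume "prefix v u"
    then obtain q where "u = v @ q" by (auto simp: prefix_def)
    then show "u = v \<or> prefix (v @ [Lft]) u \<or> prefix (v @ [Rgt]) u"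
      by (cases q; cases "hd q") auto
  qed (auto dest: append_prefixD)
  then show ?thesis using assms by (auto simp: vertices_above_def vertices_def)
qed

lemma vertices_above_leaf:
  assumes "subform_at B v = Some (Lit l)"
  shows "vertices_above B {v} = {v}"
proof -
  have "u = v" if u: "u \<in> vertices B" "prefix v u" for u
  proof -
    obtain q where "u = v @ q" using u(2) by (auto simp: prefix_def)
    then show ?thesis using u assms by (cases q) (auto simp: vertices_def subform_at_append)
  qed
  then show ?thesis using assms by (auto simp: vertices_above_def vertices_def)
qed

lemma antichain_child_notin: "antichain (insert v R) \<Longrightarrow> v \<notin> R \<Longrightarrow> v @ [d] \<notin> R"
  by (auto simp: antichain_def)

text \<open>Two prefixes of one address are comparable, so a common vertex would put two comparable
  roots into an antichain.\<close>

lemma vertices_above_disjoint: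
  assumes "antichain (R \<union> S)" "R \<inter> S = {}"
  shows "vertices_above B R \<inter> vertices_above B S = {}"
proof -
  have "False" if "r \<in> R" "s \<in> S" "prefix r u" "prefix s u" for r s u
  proof -
    have "prefix r s \<or> prefix s r" using that prefix_same_cases by blast
    then show False using assms that unfolding antichain_def by blast
  qed
  then show ?thesis by (auto simp: vertices_above_def)
qed

lemma switching_edges_on_Un:
  "switching_edges_on B \<sigma> (V \<union> W) = switching_edges_on B \<sigma> V \<union> switching_edges_on B \<sigma> W"
  by (auto simp: switching_edges_on_def)

lemma switching_edges_on_insert:
  "switching_edges_on B \<sigma> (insert v W) = switching_edges_on B \<sigma> {v} \<union> switching_edges_on B \<sigma> W"
  by (auto simp: switching_edges_on_def)

lemma switching_edges_on_single:
  "subform_at B v = Some (Lit l) \<Longrightarrow> switching_edges_on B \<sigma> {v} = {}"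
  "subform_at B v = Some (Or C D) \<Longrightarrow> switching_edges_on B \<sigma> {v} = {{v, v @ [\<sigma> v]}}"
  "subform_at B v = Some (And C D) \<Longrightarrow> switching_edges_on B \<sigma> {v} = {{v, v @ [Lft]}, {v, v @ [Rgt]}}"
  by (auto simp: switching_edges_on_def and_vertices_def or_vertices_def)
    (metis (full_types) dir.exhaust)+

lemma dual_links_linear_insert_inner:
  assumes "\<And>l. \<not> leaf_label B v l"
  shows "dual_links B (insert v W) = dual_links B W" "linear_on B (insert v W) = linear_on B W"
proof -
  have "(u \<in> insert v W \<and> leaf_label B u l) \<longleftrightarrow> (u \<in> W \<and> leaf_label B u l)" for u l
    using assms by auto
  then show "dual_links B (insert v W) = dual_links B W" "linear_on B (insert v W) = linear_on B W"
    unfolding dual_links_def linear_on_def by (simp_all only:)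
qed

text \<open>Only a shared variable could produce a link between \<open>V\<close> and
  \<open>W\<close> or a second occurrence of a literal.\<close>

lemma dual_links_linear_Un:
  assumes "\<And>u v l l'. u \<in> V \<Longrightarrow> v \<in> W \<Longrightarrow> leaf_label B u l \<Longrightarrow> leaf_label B v l'
      \<Longrightarrow> set_literal l \<inter> set_literal l' = {}"
  shows "dual_links B (V \<union> W) = dual_links B V \<union> dual_links B W"
    and "linear_on B V \<Longrightarrow> linear_on B W \<Longrightarrow> linear_on B (V \<union> W)"
proof -
  have d: "\<not> (u \<in> V \<and> v \<in> W \<and> leaf_label B u l \<and> leaf_label B v l' \<and>
      x \<in> set_literal l \<and> x \<in> set_literal l')" for u v l l' x
    using assms by blast
  show "dual_links B (V \<union> W) = dual_links B V \<union> dual_links B W"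
  proof
    show "dual_links B (V \<union> W) \<subseteq> dual_links B V \<union> dual_links B W"
    proof
      fix X assume "X \<in> dual_links B (V \<union> W)"
      then obtain u v x where X: "X = {u, v}" "u \<in> V \<union> W" "v \<in> V \<union> W"
        "leaf_label B u (Pos x)" "leaf_label B v (Neg x)"
        by (auto simp: dual_links_def)
      then have "u \<in> V \<and> v \<in> V \<or> u \<in> W \<and> v \<in> W"
        using d[of u v "Pos x" "Neg x" x] d[of v u "Neg x" "Pos x" x] by auto
      then show "X \<in> dual_links B V \<union> dual_links B W"
        using X unfolding dual_links_def by blast
    qed
    show "dual_links B V \<union> dual_links B W \<subseteq> dual_links B (V \<union> W)"
      unfolding dual_links_def by blast
  qed
  assume V: "linear_on B V" and W: "linear_on B W"
  show "linear_on B (V \<union> W)" unfolding linear_on_def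
  proof (intro ballI allI impI)
    fix u l x assume ul: "u \<in> V \<union> W \<and> leaf_label B u l" and x: "x \<in> set_literal l"
    show "(\<exists>!v. v \<in> V \<union> W \<and> leaf_label B v (Pos x)) \<and> (\<exists>!v. v \<in> V \<union> W \<and> leaf_label B v (Neg x))"
    proof (cases "u \<in> V")
      case True
      then have "(v \<in> V \<union> W \<and> leaf_label B v (Pos x)) = (v \<in> V \<and> leaf_label B v (Pos x))"
        "(v \<in> V \<union> W \<and> leaf_label B v (Neg x)) = (v \<in> V \<and> leaf_label B v (Neg x))" for v
        using d[of u v l "Pos x" x] d[of u v l "Neg x" x] ul x by auto
      then show ?thesis using V[unfolded linear_on_def, rule_format, of u l x] True ul x by simp
    next
      case False
      then have "(v \<in> V \<union> W \<and> leaf_label B v (Pos x)) = (v \<in> W \<and> leaf_label B v (Pos x))"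
        "(v \<in> V \<union> W \<and> leaf_label B v (Neg x)) = (v \<in> W \<and> leaf_label B v (Neg x))" for v
        using d[of v u "Pos x" l x] d[of v u "Neg x" l x] ul x by auto
      then show ?thesis using W[unfolded linear_on_def, rule_format, of u l x] False ul x by simp
    qed
  qed
qed

text \<open>No multiplicity in \<open>mset_set R\<close> exceeds one, so splitting its image splits
  the set of roots itself. This distributes the context of a tensor over its premises.\<close>

lemma mset_set_split:
  assumes "finite R" "image_mset s (mset_set R) = M + N"
  obtains R1 R2 where "R = R1 \<union> R2" "R1 \<inter> R2 = {}" "finite R1" "finite R2"
    "image_mset s (mset_set R1) = M" "image_mset s (mset_set R2) = N"
proof -
  obtain M' N' where MN: "mset_set R = M' + N'" "M = image_mset s M'" "N = image_mset s N'"
    using image_mset_eq_plusD[OF assms(2)] by auto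
  have one: "count M' x + count N' x \<le> 1" for x
  proof -
    have "count M' x + count N' x = count (mset_set R) x" by (simp add: MN)
    then show ?thesis by (simp add: count_mset_set')
  qed
  have "M' = mset_set (set_mset M')" "N' = mset_set (set_mset N')"
    using one
    by (auto intro!: multiset_eqI simp: count_mset_set' not_in_iff)
      (metis add_leD1 add_leD2 count_greater_zero_iff le_antisym One_nat_def Suc_leI)+
  moreover have "R = set_mset M' \<union> set_mset N'"
    using MN(1) assms(1) by (metis finite_set_mset_mset_set set_mset_union)
  moreover have "set_mset M' \<inter> set_mset N' = {}"
  proof (rule ccontr)
    assume "set_mset M' \<inter> set_mset N' \<noteq> {}"
    then obtain x where "x \<in># M'" "x \<in># N'" by auto
    then have "0 < count M' x" "0 < count N' x" by auto
    then show False using one[of x] by linarith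
  qed
  ultimately show thesis using that[of "set_mset M'" "set_mset N'"] MN by auto
qed

lemma mset_set_insert_split:
  assumes "finite R" "image_mset s (mset_set R) = add_mset a M"
  obtains r S where "R = insert r S" "r \<notin> S" "s r = a" "finite S" "image_mset s (mset_set S) = M"
proof -
  have "a \<in># image_mset s (mset_set R)" unfolding assms(2) by simp
  then obtain r where r: "r \<in> R" "s r = a"
    using assms(1) by (metis (no_types, lifting) finite_set_mset_mset_set imageE set_image_mset)
  then have R: "mset_set R = add_mset r (mset_set (R - {r}))"
    by (intro mset_set.remove[OF assms(1)])
  have "image_mset s (mset_set (R - {r})) = M"
    using assms(2)[unfolded R] r(2) by simp
  moreover have "R = insert r (R - {r})" using r(1) by blast
  ultimately show thesis using r(2) that[of r "R - {r}"] assms(1) by blast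
qed

text \<open>
  All graphs live in one fixed formula \<open>B\<close>: a derivable sequent is matched with an antichain \<open>R\<close> of
  vertices at which its members occur, so that no rule has to rename vertices.
\<close>

lemma mll_tree_graph:
  assumes "mll M" "finite R" "antichain R" "image_mset (subform_at B) (mset_set R) = image_mset Some M"
  shows "linear_on B (vertices_above B R) \<and>
    tree_graph (vertices_above B R)
      (switching_edges_on B \<sigma> (vertices_above B R) \<union> dual_links B (vertices_above B R))"
  using assms
proof (induction arbitrary: R rule: mll.induct)
  case (ax x)
  obtain u S where u: "R = insert u S" "u \<notin> S" "finite S" "subform_at B u = Some (Lit (Pos x))"
    "image_mset (subform_at B) (mset_set S) = {#Some (Lit (Neg x))#}"
    using mset_set_insert_split[OF ax.prems(1), of "subform_at B" "Some (Lit (Pos x))"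
        "{#Some (Lit (Neg x))#}"] ax.prems(3) by (metis image_mset_add_mset image_mset_single)
  obtain v S' where v: "S = insert v S'" "v \<notin> S'" "finite S'" "subform_at B v = Some (Lit (Neg x))"
    "image_mset (subform_at B) (mset_set S') = {#}"
    using mset_set_insert_split[OF u(3,5)] by metis
  have R: "R = {u, v}" using u v by (auto simp: mset_set_empty_iff)
  have V: "vertices_above B R = {u, v}"
    using R u v by (simp add: vertices_above_insert[of B u "{v}"] vertices_above_leaf insert_commute)
  have uv: "u \<noteq> v" using u v by auto
  have ll: "leaf_label B u l \<longleftrightarrow> l = Pos x" "leaf_label B v l \<longleftrightarrow> l = Neg x" for l
    using u v by (auto simp: leaf_label_def)
  have "switching_edges_on B \<sigma> {u, v} = {}"
    using u v by (simp add: switching_edges_on_insert[of _ _ u "{v}"] switching_edges_on_single)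
  moreover have "dual_links B {u, v} = {{u, v}}"
  proof
    show "dual_links B {u, v} \<subseteq> {{u, v}}" using uv ll by (auto simp: dual_links_def)
    show "{{u, v}} \<subseteq> dual_links B {u, v}" unfolding dual_links_def using ll by blast
  qed
  moreover have "linear_on B {u, v}"
    using uv ll by (auto simp: linear_on_def)
  moreover have "tree_graph {u, v} {{u, v}}"
    using tree_graph.pendant[OF tree_graph.single, of u v v] uv by simp
  ultimately show ?case using V by simp
next
  case (par T U M)
  obtain v S where v: "R = insert v S" "v \<notin> S" "finite S" "subform_at B v = Some (Or T U)"
    "image_mset (subform_at B) (mset_set S) = image_mset Some M"
    using mset_set_insert_split[OF par.prems(1), of "subform_at B" "Some (Or T U)"
        "image_mset Some M"] par.prems(3) by (metis image_mset_add_mset)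
  \<comment> \<open>Read upwards, the rule trades the root \<open>v\<close> for its two arguments.
    One tree already spans both, so the single edge kept by \<open>\<sigma>\<close> attaches
    \<open>v\<close> as a pendant vertex.\<close>
  let ?R = "insert (v @ [Lft]) (insert (v @ [Rgt]) S)"
  have ac: "antichain ?R"
    using par.prems(2) v by (auto simp: antichain_def dest: append_prefixD)
  have notin: "v @ [d] \<notin> S" for d
    using antichain_child_notin[of v S] par.prems(2) v by simp
  have ms: "image_mset (subform_at B) (mset_set ?R) = image_mset Some (add_mset T (add_mset U M))"
    using v notin by (simp add: subform_at_snoc)
  let ?V = "vertices_above B ?R"
  have IH: "linear_on B ?V" "tree_graph ?V (switching_edges_on B \<sigma> ?V \<union> dual_links B ?V)"
    using par.IH[OF _ ac ms] v by auto
  have V: "vertices_above B R = insert v ?V"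
    using v vertices_above_binary[of B v T U]
    by (simp add: vertices_above_insert[of B v S]
        vertices_above_insert[of B "v @ [Lft]" "insert (v @ [Rgt]) S"]
        vertices_above_insert[of B "v @ [Rgt]" S] Un_assoc)
  have nl: "\<not> leaf_label B v l" for l using v by (simp add: leaf_label_def)
  have "v \<notin> ?V"
    using v par.prems(2) by (auto simp: vertices_above_def antichain_def dest: append_prefixD)
  moreover have "v @ [\<sigma> v] \<in> ?V"
    using v by (cases "\<sigma> v") (auto simp: vertices_above_def vertices_def subform_at_snoc)
  ultimately have "tree_graph (insert v ?V)
      (insert {v, v @ [\<sigma> v]} (switching_edges_on B \<sigma> ?V \<union> dual_links B ?V))"
    by (intro tree_graph.pendant IH)
  then show ?case
    using IH(1) v(4) by (simp add: V dual_links_linear_insert_inner[OF nl]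
        switching_edges_on_insert[of B \<sigma> v ?V] switching_edges_on_single(2))
next
  case (tensor T M U N)
  obtain v S where v: "R = insert v S" "v \<notin> S" "finite S" "subform_at B v = Some (And T U)"
    "image_mset (subform_at B) (mset_set S) = image_mset Some M + image_mset Some N"
    using mset_set_insert_split[OF tensor.prems(1), of "subform_at B" "Some (And T U)"
        "image_mset Some M + image_mset Some N"] tensor.prems(3)
    by (metis image_mset_add_mset image_mset_union)
  obtain S1 S2 where S: "S = S1 \<union> S2" "S1 \<inter> S2 = {}" "finite S1" "finite S2"
    "image_mset (subform_at B) (mset_set S1) = image_mset Some M"
    "image_mset (subform_at B) (mset_set S2) = image_mset Some N"
    using mset_set_split[OF v(3,5)] by metis
  let ?R1 = "insert (v @ [Lft]) S1" and ?R2 = "insert (v @ [Rgt]) S2"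
  have ac: "antichain (?R1 \<union> ?R2)"
    using tensor.prems(2) v S by (auto simp: antichain_def dest: append_prefixD)
  then have ac1: "antichain ?R1" and ac2: "antichain ?R2"
    by (auto simp: antichain_def)
  have notin: "v @ [d] \<notin> S" for d
    using antichain_child_notin[of v S] tensor.prems(2) v by simp
  have ms: "image_mset (subform_at B) (mset_set ?R1) = image_mset Some (add_mset T M)"
    "image_mset (subform_at B) (mset_set ?R2) = image_mset Some (add_mset U N)"
    using v S notin by (simp_all add: subform_at_snoc)
  let ?V = "vertices_above B ?R1" and ?W = "vertices_above B ?R2"
  have IH1: "linear_on B ?V" "tree_graph ?V (switching_edges_on B \<sigma> ?V \<union> dual_links B ?V)"
    using tensor.IH(1)[OF _ ac1 ms(1)] S by auto
  have IH2: "linear_on B ?W" "tree_graph ?W (switching_edges_on B \<sigma> ?W \<union> dual_links B ?W)"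
    using tensor.IH(2)[OF _ ac2 ms(2)] S by auto
  have V: "vertices_above B R = insert v (?V \<union> ?W)"
    using v S vertices_above_binary[of B v T U]
    by (simp add: vertices_above_insert[of B v "S1 \<union> S2"]
        vertices_above_insert[of B "v @ [Lft]" S1] vertices_above_insert[of B "v @ [Rgt]" S2]
        vertices_above_Un) blast
  have disj: "?V \<inter> ?W = {}"
    using ac S notin by (intro vertices_above_disjoint) auto
  have nl: "\<not> leaf_label B v l" for l using v by (simp add: leaf_label_def)
  \<comment> \<open>Disjointness of variables is a condition on the formulas of the premises; this
    fact carries it to the leaves above their roots.\<close>
  have vars: "\<exists>C. C \<in># Q \<and> x \<in> set_form C"
    if P: "image_mset (subform_at B) (mset_set P) = image_mset Some Q" "finite P"
      and u: "u \<in> vertices_above B P" "leaf_label B u l" "x \<in> set_literal l" for P Q u l x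
  proof -
    obtain r where r: "r \<in> P" "prefix r u" using u(1) by (auto simp: vertices_above_def)
    then have "subform_at B r \<in># image_mset (subform_at B) (mset_set P)" using P(2) by simp
    then obtain C where "C \<in># Q" "subform_at B r = Some C" using P(1) by auto
    then show ?thesis using leaf_label_set_form u r by metis
  qed
  have sep: "set_literal l \<inter> set_literal l' = {}"
    if "u \<in> ?V" "w \<in> ?W" "leaf_label B u l" "leaf_label B w l'" for u w l l'
  proof (rule ccontr)
    assume "set_literal l \<inter> set_literal l' \<noteq> {}"
    then obtain x where "x \<in> set_literal l" "x \<in> set_literal l'" by auto
    then have "\<exists>C. C \<in># add_mset T M \<and> x \<in> set_form C" "\<exists>C. C \<in># add_mset U N \<and> x \<in> set_form C"
      using vars[OF ms(1) _ that(1,3)] vars[OF ms(2) _ that(2,4)] S by auto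
    then show False using tensor.hyps(3) by blast
  qed
  have dual: "dual_links B (?V \<union> ?W) = dual_links B ?V \<union> dual_links B ?W"
    by (rule dual_links_linear_Un(1)) (rule sep)
  have lin: "linear_on B (?V \<union> ?W)"
    by (rule dual_links_linear_Un(2)[OF _ IH1(1) IH2(1)]) (rule sep)
  have "v \<notin> ?V \<union> ?W"
    using v S tensor.prems(2) by (auto simp: vertices_above_def antichain_def dest: append_prefixD)
  moreover have mem: "v @ [Lft] \<in> ?V" "v @ [Rgt] \<in> ?W"
    using v by (auto simp: vertices_above_def vertices_def subform_at_snoc)
  \<comment> \<open>A conjunction keeps both edges: one hangs \<open>v\<close> on the left tree as a
    pendant vertex, the other joins the result to the right tree.\<close>
  ultimately have "tree_graph (insert v ?V)
      (insert {v, v @ [Lft]} (switching_edges_on B \<sigma> ?V \<union> dual_links B ?V))"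
    by (intro tree_graph.pendant IH1) auto
  then have "tree_graph (insert v ?V \<union> ?W)
      (insert {v, v @ [Rgt]} (insert {v, v @ [Lft]} (switching_edges_on B \<sigma> ?V \<union> dual_links B ?V)
        \<union> (switching_edges_on B \<sigma> ?W \<union> dual_links B ?W)))"
    using disj mem \<open>v \<notin> ?V \<union> ?W\<close> by (intro tree_graph_join IH2) auto
  moreover have "insert {v, v @ [Rgt]} (insert {v, v @ [Lft]} (switching_edges_on B \<sigma> ?V \<union> dual_links B ?V)
        \<union> (switching_edges_on B \<sigma> ?W \<union> dual_links B ?W)) =
      switching_edges_on B \<sigma> (vertices_above B R) \<union> dual_links B (vertices_above B R)"
    unfolding V dual_links_linear_insert_inner[OF nl] dual
      switching_edges_on_insert[of B \<sigma> v "?V \<union> ?W"] switching_edges_on_Un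
      switching_edges_on_single(3)[OF v(4)]
    by blast
  moreover have "linear_on B (vertices_above B R)"
    unfolding V dual_links_linear_insert_inner[OF nl] by (rule lin)
  ultimately show ?case by (simp add: V)
qed

lemma subform_at_map: "subform_at (map_form g B) v = map_option (map_form g) (subform_at B v)"
  by (induction B v rule: subform_at.induct) (auto split: dir.splits)

text \<open>Switchings and connectivity see only addresses, so renaming variables leaves them
  intact. The links are taken from \<open>B\<close> because a non-injective \<open>g\<close> may
  merge variables and make the pairing ambiguous.\<close>

lemma mll_proof_net_map:
  assumes "mll {#B#}"
  shows "mll_proof_net (map_form g B) (dual_links B (vertices B))"
proof -
  let ?A = "map_form g B"
  have V: "vertices_above B {[]} = vertices B" by (auto simp: vertices_above_def)
  have tree: "linear_on B (vertices B)"
    "tree_graph (vertices B) (switching_edges_on B \<sigma> (vertices B) \<union> dual_links B (vertices B))" for \<sigma>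
    using mll_tree_graph[OF assms, of "{[]}" B \<sigma>] by (auto simp: V antichain_def)
  have vertices: "vertices ?A = vertices B" by (simp add: vertices_def subform_at_map)
  have and_vertices: "and_vertices ?A = and_vertices B"
  proof -
    have "(\<exists>C' D'. map_option (map_form g) z = Some (And C' D')) \<longleftrightarrow> (\<exists>C' D'. z = Some (And C' D'))" for z
      by (cases z; cases "the z") auto
    then show ?thesis by (simp add: and_vertices_def subform_at_map)
  qed
  have or_vertices: "or_vertices ?A = or_vertices B"
  proof -
    have "(\<exists>C' D'. map_option (map_form g) z = Some (Or C' D')) \<longleftrightarrow> (\<exists>C' D'. z = Some (Or C' D'))" for z
      by (cases z; cases "the z") auto
    then show ?thesis by (simp add: or_vertices_def subform_at_map)
  qed
  have leaf: "leaf_label ?A u (map_literal g l)" if "leaf_label B u l" for u l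
    using that by (simp add: leaf_label_def subform_at_map)
  have leaves: "leaves ?A = leaves B"
  proof -
    have "(\<exists>l. map_option (map_form g) z = Some (Lit l)) \<longleftrightarrow> (\<exists>l. z = Some (Lit l))" for z
      by (cases z; cases "the z") auto
    then show ?thesis by (simp add: leaves_def leaf_label_def subform_at_map)
  qed
  have sub: "and_vertices B \<subseteq> vertices B" "or_vertices B \<subseteq> vertices B" "leaves B \<subseteq> vertices B"
    by (auto simp: and_vertices_def or_vertices_def vertices_def leaves_def leaf_label_def)
  have edges: "switching_edges ?A \<sigma> = switching_edges_on B \<sigma> (vertices B)" for \<sigma>
    unfolding switching_edges_def switching_edges_on_def and_vertices or_vertices
    using sub by blast
  have uniq: "l = l'" if "leaf_label B u l" "leaf_label B u l'" for u l l'
    using that by (simp add: leaf_label_def)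
  have "partition_on (leaves B) (dual_links B (vertices B))"
  proof (rule partition_onI)
    show "\<Union>(dual_links B (vertices B)) = leaves B"
    proof
      show "\<Union>(dual_links B (vertices B)) \<subseteq> leaves B"
        by (auto simp: dual_links_def leaves_def)
      show "leaves B \<subseteq> \<Union>(dual_links B (vertices B))"
      proof
        fix u assume "u \<in> leaves B"
        then obtain l where l: "leaf_label B u l" "u \<in> vertices B"
          using sub by (auto simp: leaves_def)
        obtain x where x: "l = Pos x \<or> l = Neg x" by (cases l) auto
        then have "x \<in> set_literal l" by auto
        then obtain v w where "v \<in> vertices B" "leaf_label B v (Pos x)"
          "w \<in> vertices B" "leaf_label B w (Neg x)"
          using tree(1) l unfolding linear_on_def by metis
        then show "u \<in> \<Union>(dual_links B (vertices B))"
          using l x by (auto simp: dual_links_def)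
      qed
    qed
    show "disjnt X Y" if XY: "X \<in> dual_links B (vertices B)" "Y \<in> dual_links B (vertices B)" "X \<noteq> Y"
      for X Y
    proof -
      obtain a b x where X: "X = {a, b}" "a \<in> vertices B" "b \<in> vertices B"
        "leaf_label B a (Pos x)" "leaf_label B b (Neg x)"
        using XY by (auto simp: dual_links_def)
      obtain c d y where Y: "Y = {c, d}" "c \<in> vertices B" "d \<in> vertices B"
        "leaf_label B c (Pos y)" "leaf_label B d (Neg y)"
        using XY by (auto simp: dual_links_def)
      have "x \<noteq> y"
      proof
        assume "x = y"
        then have "a = c" "b = d"
          using tree(1) X Y unfolding linear_on_def by (metis literal.set_intros(1))+
        then show False using XY X Y by simp
      qed
      then show ?thesis
        using X Y uniq by (auto simp: disjnt_def)
    qed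
    show "{} \<notin> dual_links B (vertices B)" by (auto simp: dual_links_def)
  qed
  then have "axiom_links ?A (dual_links B (vertices B))"
    unfolding axiom_links_def leaves
    by (auto simp: dual_links_def dest!: leaf) blast
  then show ?thesis
    unfolding mll_proof_net_def vertices edges
    using tree_graph_connected[OF tree(2)] tree_graph_acyclic[OF tree(2)] by blast
qed

section \<open>Completeness\<close>

lemma set_form_map_mset:
  "(\<Union>B \<in> set_mset (add_mset (map_form g T) (image_mset (map_form g) M)). set_form B) =
     g ` (\<Union>B \<in> set_mset (add_mset T M). set_form B)"
  by (auto simp: form.set_map)

text \<open>Injectivity keeps the variables of the two premises of a tensor disjoint.\<close>

lemma mll_map_inj: "mll M \<Longrightarrow> inj g \<Longrightarrow> mll (image_mset (map_form g) M)"
proof (induction rule: mll.induct)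
  case (ax x)
  then show ?case using mll.ax[of "g x"] by simp
next
  case (par T U M)
  then show ?case using mll.par by simp
next
  case (tensor T M U N)
  have "mll (add_mset (map_form g T) (image_mset (map_form g) M))"
    "mll (add_mset (map_form g U) (image_mset (map_form g) N))"
    using tensor.IH tensor.prems by simp_all
  then have "mll (add_mset (And (map_form g T) (map_form g U))
      (image_mset (map_form g) M + image_mset (map_form g) N))"
  proof (rule mll.tensor)
    show "(\<Union>B \<in> set_mset (add_mset (map_form g T) (image_mset (map_form g) M)). set_form B) \<inter>
        (\<Union>B \<in> set_mset (add_mset (map_form g U) (image_mset (map_form g) N)). set_form B) = {}"
      unfolding set_form_map_mset image_Int[OF tensor.prems, symmetric] tensor.hyps(3) by simp
  qed
  then show ?case by simp
qed

text \<open>Cliques seen through their labels only, so that formulas of different shape can be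
  compared without a map between their leaves.\<close>

fun lit_cliques :: "'v form \<Rightarrow> 'v literal set set" where
  "lit_cliques (Lit l) = {{l}}"
| "lit_cliques (And A B) = {K \<union> L | K L. K \<in> lit_cliques A \<and> L \<in> lit_cliques B}"
| "lit_cliques (Or A B) = lit_cliques A \<union> lit_cliques B"

lemma lit_cliques_map_form: "lit_cliques (map_form g A) = image (map_literal g) ` lit_cliques A"
proof (induction A)
  case (And A B)
  let ?f = "image (map_literal g)"
  have "lit_cliques (map_form g (And A B)) =
      {?f K \<union> ?f L | K L. K \<in> lit_cliques A \<and> L \<in> lit_cliques B}"
    unfolding form.map lit_cliques.simps And by blast
  also have "\<dots> = ?f ` lit_cliques (And A B)"
    unfolding lit_cliques.simps image_Un[symmetric] by blast
  finally show ?case .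
qed (simp_all add: image_Un)

lemma lit_cliques_nonempty: "lit_cliques A \<noteq> {}"
  by (induction A) auto

text \<open>Every leaf survives in some resolution, so a condition on all cliques reaches each
  single leaf. At a conjunction any clique of the other argument completes the given one.\<close>

lemma leaf_in_lit_clique: "leaf_label A v l \<Longrightarrow> \<exists>K \<in> lit_cliques A. l \<in> K"
proof (induction A arbitrary: v)
  case (Lit l')
  then show ?case by (cases v) (auto simp: leaf_label_def)
next
  case (And A B)
  obtain KA KB where "KA \<in> lit_cliques A" "KB \<in> lit_cliques B"
    using lit_cliques_nonempty by blast
  moreover have "(\<exists>K \<in> lit_cliques A. l \<in> K) \<or> (\<exists>K \<in> lit_cliques B. l \<in> K)"
    using And by (cases v) (auto simp: leaf_label_def split: dir.splits)
  ultimately show ?case by auto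
next
  case (Or A B)
  then show ?case by (cases v) (auto simp: leaf_label_def split: dir.splits)
qed

definition label_at :: "'v form \<Rightarrow> pos \<Rightarrow> 'v literal" where
  "label_at A v = (case subform_at A v of Some (Lit l) \<Rightarrow> l)"

lemma label_at_eq: "leaf_label A v l \<Longrightarrow> label_at A v = l"
  by (simp add: leaf_label_def label_at_def)

lemma label_at_simps:
  "label_at (Lit l) [] = l"
  "label_at (And A B) (d # v) = label_at (case d of Lft \<Rightarrow> A | Rgt \<Rightarrow> B) v"
  "label_at (Or A B) (d # v) = label_at (case d of Lft \<Rightarrow> A | Rgt \<Rightarrow> B) v"
  by (simp_all add: label_at_def)

lemma label_at_image_lit_clique: "K \<in> res_cliques A \<Longrightarrow> label_at A ` K \<in> lit_cliques A"
proof (induction A arbitrary: K)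
  case (Lit l)
  then show ?case by (simp add: label_at_simps)
next
  case (And A B)
  then obtain K1 K2 where K: "K = Cons Lft ` K1 \<union> Cons Rgt ` K2"
    "K1 \<in> res_cliques A" "K2 \<in> res_cliques B" by auto
  then have "label_at (And A B) ` K = label_at A ` K1 \<union> label_at B ` K2"
    by (simp add: image_Un image_image label_at_simps)
  then show ?case
    using And.IH(1)[OF K(2)] And.IH(2)[OF K(3)] by (simp only: lit_cliques.simps) blast
next
  case (Or A B)
  then show ?case by (auto simp: image_image label_at_simps)
qed

fun atom :: "'v literal \<Rightarrow> 'v" where
  "atom (Pos x) = x"
| "atom (Neg x) = x"

lemma atom_map_literal [simp]: "atom (map_literal g l) = g (atom l)"
  by (cases l) auto

text \<open>Each variable is paired with the address of its leaf, so all leaves carry different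
  literals and a set of literals determines a set of leaves.\<close>

fun address_form :: "'v form \<Rightarrow> ('v \<times> pos) form" where
  "address_form (Lit l) = Lit (map_literal (\<lambda>x. (x, [])) l)"
| "address_form (And A B) =
     And (map_form (apsnd (Cons Lft)) (address_form A)) (map_form (apsnd (Cons Rgt)) (address_form B))"
| "address_form (Or A B) =
     Or (map_form (apsnd (Cons Lft)) (address_form A)) (map_form (apsnd (Cons Rgt)) (address_form B))"

lemma map_form_fst_address_form: "map_form fst (address_form A) = A"
  by (induction A) (auto simp: form.map_comp literal.map_comp o_def form.map_ident literal.map_ident)

lemma lit_cliques_address_form:
  assumes "K \<in> lit_cliques (address_form A)"
  shows "(snd \<circ> atom) ` K \<in> res_cliques A"
    and "l \<in> K \<Longrightarrow> leaf_label A (snd (atom l)) (map_literal fst l)"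
proof -
  have "(snd \<circ> atom) ` K \<in> res_cliques A \<and>
      (\<forall>l \<in> K. leaf_label A (snd (atom l)) (map_literal fst l))"
    using assms
  proof (induction A arbitrary: K)
    case (Lit l)
    then show ?case
      by (simp add: leaf_label_def literal.map_comp o_def literal.map_ident)
  next
    case (And A B)
    then obtain K1 K2 where K: "K1 \<in> lit_cliques (address_form A)"
      "K2 \<in> lit_cliques (address_form B)"
      "K = map_literal (apsnd (Cons Lft)) ` K1 \<union> map_literal (apsnd (Cons Rgt)) ` K2"
      by (auto simp: lit_cliques_map_form)
    have "(snd \<circ> atom) ` K = Cons Lft ` (snd \<circ> atom) ` K1 \<union> Cons Rgt ` (snd \<circ> atom) ` K2"
      by (simp add: K(3) image_Un image_image)
    then have "(snd \<circ> atom) ` K \<in> res_cliques (And A B)"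
      using And.IH(1)[OF K(1)] And.IH(2)[OF K(2)] by (simp only: res_cliques.simps) blast
    moreover have "\<forall>l \<in> K. leaf_label (And A B) (snd (atom l)) (map_literal fst l)"
      using And.IH K by (auto simp: leaf_label_Cons literal.map_comp o_def)
    ultimately show ?case by blast
  next
    case (Or A B)
    then consider
        K1 where "K1 \<in> lit_cliques (address_form A)" "K = map_literal (apsnd (Cons Lft)) ` K1"
      | K2 where "K2 \<in> lit_cliques (address_form B)" "K = map_literal (apsnd (Cons Rgt)) ` K2"
      by (auto simp: lit_cliques_map_form)
    then show ?case
    proof cases
      case 1
      then have "(snd \<circ> atom) ` K = Cons Lft ` (snd \<circ> atom) ` K1"
        by (simp add: image_image)
      then show ?thesis
        using Or.IH(1)[OF 1(1)] 1 by (auto simp: leaf_label_Cons literal.map_comp o_def)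
    next
      case 2
      then have "(snd \<circ> atom) ` K = Cons Rgt ` (snd \<circ> atom) ` K2"
        by (simp add: image_image)
      then show ?thesis
        using Or.IH(2)[OF 2(1)] 2 by (auto simp: leaf_label_Cons literal.map_comp o_def)
    qed
  qed
  then show "(snd \<circ> atom) ` K \<in> res_cliques A"
    and "l \<in> K \<Longrightarrow> leaf_label A (snd (atom l)) (map_literal fst l)" by auto
qed

text \<open>
  A variable \<open>(x, y, n)\<close> of a linear formula stands for an axiom link between a copy of the literal
  \<open>Pos x\<close> and a copy of the literal \<open>Neg y\<close>; the number \<open>n\<close> separates different links.
\<close>

fun target :: "('u \<times> 'u \<times> nat) literal \<Rightarrow> 'u literal" where
  "target (Pos (x, y, n)) = Pos x"
| "target (Neg (x, y, n)) = Neg y"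

text \<open>Literal-level substitute for a clique-preserving map, with \<open>target\<close> in the
  role of the map. The condition \<open>h x = h y\<close> makes the two ends of a link dual once
  variables are renamed by \<open>h\<close>.\<close>

definition covers :: "('u \<Rightarrow> 'v) \<Rightarrow> ('u \<times> 'u \<times> nat) form \<Rightarrow> 'u form \<Rightarrow> bool" where
  "covers h T C \<longleftrightarrow> (\<forall>(x, y, n) \<in> set_form T. h x = h y) \<and>
     (\<forall>K \<in> lit_cliques T. target ` K \<in> lit_cliques C)"

text \<open>Produces fresh links with the same ends: only the number changes, so
  \<open>target\<close> is unaffected.\<close>

definition reindex :: "(nat \<Rightarrow> nat) \<Rightarrow> 'u \<times> 'u \<times> nat \<Rightarrow> 'u \<times> 'u \<times> nat" where
  "reindex k = apsnd (apsnd k)"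

lemma target_reindex: "target (map_literal (reindex k) l) = target l"
  by (cases l rule: target.cases) (auto simp: reindex_def)

lemma covers_reindex:
  assumes "covers h T C"
  shows "covers h (map_form (reindex k) T) C"
proof -
  have "target ` K \<in> lit_cliques C" if "K \<in> lit_cliques (map_form (reindex k) T)" for K
    using that assms by (auto simp: covers_def lit_cliques_map_form image_image target_reindex)
  moreover have "\<forall>(x, y, n) \<in> set_form (map_form (reindex k) T). h x = h y"
    using assms by (auto simp: covers_def form.set_map reindex_def)
  ultimately show ?thesis by (simp add: covers_def)
qed

lemma covers_Or_left: "covers h T C \<Longrightarrow> covers h T (Or C D)"
  and covers_Or_right: "covers h T D \<Longrightarrow> covers h T (Or C D)"
  by (auto simp: covers_def)

text \<open>The cliques of a disjunction are those of its two arguments together, so contraction is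
  a mere union.\<close>

lemma covers_Or: "covers h T C \<Longrightarrow> covers h U C \<Longrightarrow> covers h (Or T U) C"
  by (auto simp: covers_def)

lemma covers_And:
  assumes "covers h T C" "covers h U D"
  shows "covers h (And T U) (And C D)"
proof -
  have "target ` (K \<union> L) \<in> lit_cliques (And C D)"
    if "K \<in> lit_cliques T" "L \<in> lit_cliques U" for K L
    using assms that unfolding covers_def image_Un lit_cliques.simps by blast
  then show ?thesis using assms by (auto simp: covers_def)
qed

text \<open>Pars merge the members of \<open>P\<close> two at a time. At least one member must be
  present, since the calculus cannot introduce a formula by weakening.\<close>

lemma mll_contract:
  assumes "mll (P + N)" "P \<noteq> {#}" "\<forall>T \<in># P. covers h T C"
  shows "\<exists>T. mll (add_mset T N) \<and> covers h T C"
  using assms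
proof (induction "size P" arbitrary: P rule: less_induct)
  case less
  obtain T Q where P: "P = add_mset T Q" using less.prems(2) by (metis multiset_cases)
  show ?case
  proof (cases "Q = {#}")
    case True
    then show ?thesis using less.prems P by auto
  next
    case False
    then obtain U R where Q: "Q = add_mset U R" by (metis multiset_cases)
    have "mll (add_mset (Or T U) R + N)"
      using mll.par[of T U "R + N"] less.prems(1) P Q by simp
    then show ?thesis
      using less.hyps[of "add_mset (Or T U) R"] less.prems(3) P Q by (simp add: covers_Or)
  qed
qed

text \<open>A member of \<open>\<Gamma>\<close> may be covered several times or not at all. This
  freedom absorbs contraction and weakening and leaves a purely linear derivation. The induction is
  on the total size of the sequent.\<close>

lemma mll_cover:
  fixes h :: "'u \<Rightarrow> 'v"
  assumes "\<And>\<nu>. \<exists>C \<in> set \<Gamma>. form_true \<nu> (map_form h C)"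
  shows "\<exists>M. mll M \<and> (\<forall>T \<in># M. \<exists>C \<in> set \<Gamma>. covers h T C)"
  using assms
proof (induction "sum_list (map size \<Gamma>)" arbitrary: \<Gamma> rule: less_induct)
  case less
  show ?case
  proof (cases "\<exists>C \<in> set \<Gamma>. \<nexists>l. C = Lit l")
    case True
    then obtain C xs ys where \<Gamma>: "\<Gamma> = xs @ C # ys" and C: "\<nexists>l. C = Lit l"
      by (metis split_list)
    show ?thesis
    proof (cases C)
      case (Lit l)
      then show ?thesis using C by simp
    next
      case (Or D E)
      have "\<exists>B \<in> set (xs @ D # E # ys). form_true \<nu> (map_form h B)" for \<nu>
        using less.prems[of \<nu>] \<Gamma> Or by auto
      then obtain M where "mll M" "\<forall>T \<in># M. \<exists>B \<in> set (xs @ D # E # ys). covers h T B"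
        using less.hyps[of "xs @ D # E # ys"] \<Gamma> Or by auto
      then show ?thesis
        using \<Gamma> Or covers_Or_left covers_Or_right by (intro exI[of _ M]) fastforce
    next
      case (And D E)
      let ?\<Delta> = "set xs \<union> set ys"
      \<comment> \<open>Members of a premise outside \<open>rest\<close> can only cover the active
        conjunct; they are the ones to be contracted.\<close>
      define rest where "rest T \<longleftrightarrow> (\<exists>B \<in> ?\<Delta>. covers h T B)" for T
      have half: "(\<exists>M. mll M \<and> (\<forall>T \<in># M. rest T)) \<or>
          (\<exists>T N. mll (add_mset T N) \<and> covers h T B \<and> (\<forall>T \<in># N. rest T))"
        if B: "B = D \<or> B = E" for B
      proof -
        have "\<exists>B' \<in> set (xs @ B # ys). form_true \<nu> (map_form h B')" for \<nu>
          using less.prems[of \<nu>] \<Gamma> And B by auto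
        then obtain M where M: "mll M" "\<forall>T \<in># M. \<exists>B' \<in> set (xs @ B # ys). covers h T B'"
          using less.hyps[of "xs @ B # ys"] \<Gamma> And B by auto
        let ?N = "filter_mset rest M" and ?P = "filter_mset (\<lambda>T. \<not> rest T) M"
        have MPN: "M = ?P + ?N" by (metis multiset_partition add.commute)
        have "\<forall>T \<in># ?P. covers h T B" using M(2) by (auto simp: rest_def)
        then show ?thesis
        proof (cases "?P = {#}")
          case True
          then show ?thesis
            using M(1) MPN by (metis add_0 filter_mset_eq_conv set_mset_filter mem_Collect_eq)
        next
          case False
          then obtain T where "mll (add_mset T ?N)" "covers h T B"
            using mll_contract[of ?P ?N h B] M(1) MPN \<open>\<forall>T \<in># ?P. covers h T B\<close> by auto
          then show ?thesis
            by (metis (mono_tags, lifting) filter_mset_eq_conv mem_Collect_eq set_mset_filter)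
        qed
      qed
      show ?thesis
      proof (cases "\<exists>M. mll M \<and> (\<forall>T \<in># M. rest T)")
        case True
        then show ?thesis using \<Gamma> by (fastforce simp: rest_def)
      next
        case False
        then obtain T M U N where
          T: "mll (add_mset T M)" "covers h T D" "\<forall>T \<in># M. rest T" and
          U: "mll (add_mset U N)" "covers h U E" "\<forall>T \<in># N. rest T"
          using half[of D] half[of E] by auto
        \<comment> \<open>Even and odd numbers keep the variables of the two premises apart, as the
          tensor rule demands.\<close>
        define r :: "'u \<times> 'u \<times> nat \<Rightarrow> _" where "r = reindex (\<lambda>n. 2 * n)"
        define s :: "'u \<times> 'u \<times> nat \<Rightarrow> _" where "s = reindex (\<lambda>n. 2 * n + 1)"
        have inj: "inj r" "inj s" by (auto simp: inj_def r_def s_def reindex_def)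
        have rs: "r a \<noteq> s b" for a b
        proof -
          have "snd (snd (r a)) \<noteq> snd (snd (s b))"
            unfolding r_def s_def reindex_def by simp presburger
          then show ?thesis by auto
        qed
        have "mll (add_mset (And (map_form r T) (map_form s U))
            (image_mset (map_form r) M + image_mset (map_form s) N))"
          using mll_map_inj[OF T(1) inj(1)] mll_map_inj[OF U(1) inj(2)] rs
          by (intro mll.tensor)
            (simp_all only: image_mset_add_mset set_form_map_mset, blast)
        moreover have "covers h (And (map_form r T) (map_form s U)) C"
          using T(2) U(2) And by (auto simp: r_def s_def intro!: covers_And covers_reindex)
        moreover have "rest (map_form r T)" "rest (map_form s T)" if "rest T" for T
          using that covers_reindex unfolding rest_def r_def s_def by blast+
        then have "\<forall>B \<in># image_mset (map_form r) M + image_mset (map_form s) N. rest B"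
          using T(3) U(3) by auto
        ultimately show ?thesis
          using \<Gamma>
          by (intro exI[of _ "add_mset (And (map_form r T) (map_form s U))
              (image_mset (map_form r) M + image_mset (map_form s) N)"])
            (fastforce simp: rest_def)
      qed
    qed
  next
    case False
    have "\<exists>x y. Lit (Pos x) \<in> set \<Gamma> \<and> Lit (Neg y) \<in> set \<Gamma> \<and> h x = h y"
    proof (rule ccontr)
      assume no: "\<not> ?thesis"
      \<comment> \<open>The countermodel makes a variable false exactly when it occurs positively.
        It falsifies every positive literal, and a true negative literal would complete a dual
        pair.\<close>
      obtain C where C: "C \<in> set \<Gamma>"
        "form_true (\<lambda>v. \<not> (\<exists>x. Lit (Pos x) \<in> set \<Gamma> \<and> h x = v)) (map_form h C)"
        using less.prems by blast
      then obtain l where "C = Lit l" using False by blast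
      then show False using C no by (cases l) auto
    qed
    then obtain x y where xy: "Lit (Pos x) \<in> set \<Gamma>" "Lit (Neg y) \<in> set \<Gamma>" "h x = h y" by blast
    \<comment> \<open>The number 0 is arbitrary; links are separated by renumbering when a
      conjunction combines two derivations.\<close>
    then have "covers h (Lit (Pos (x, y, 0))) (Lit (Pos x))"
      "covers h (Lit (Neg (x, y, 0))) (Lit (Neg y))"
      by (auto simp: covers_def)
    then show ?thesis
      using mll.ax[of "(x, y, 0)"] xy
      by (intro exI[of _ "{#Lit (Pos (x, y, 0)), Lit (Neg (x, y, 0))#}"]) auto
  qed
qed

section \<open>Reading the labels and the map off the variables\<close>

lemma valid_imp_combinatorial_proof:
  fixes A :: "'v form"
  assumes "valid A"
  shows "\<exists>A' \<Lambda> f. combinatorial_proof A A' \<Lambda> f"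
proof -
  have "\<exists>C \<in> set [address_form A]. form_true \<nu> (map_form fst C)" for \<nu>
    using assms by (simp add: map_form_fst_address_form valid_def)
  then obtain M where M: "mll M" "\<forall>T \<in># M. covers fst T (address_form A)"
    using mll_cover[of "[address_form A]" fst] by auto
  \<comment> \<open>No rule derives the empty sequent, so contraction can leave exactly one
    formula.\<close>
  have "M \<noteq> {#}" using M(1) by cases auto
  then obtain B where B: "mll {#B#}" and cov: "covers fst B (address_form A)"
    using mll_contract[of M "{#}" fst "address_form A"] M by auto
  \<comment> \<open>The original variable at the positive end of a link; \<open>covers\<close> makes
    the one at the negative end equal to it.\<close>
  define g :: "('v \<times> pos) \<times> ('v \<times> pos) \<times> nat \<Rightarrow> 'v" where "g = fst \<circ> fst"
  let ?A' = "map_form g B"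
  \<comment> \<open>The \<open>target\<close> of the label is a literal of
    \<open>address_form A\<close>, whose variable contains the address of the leaf to be
    hit.\<close>
  define f where "f v = snd (atom (target (label_at B v)))" for v
  have label: "leaf_label A (f v) (map_literal g l)" if l: "leaf_label B v l" for v l
  proof -
    obtain K where "K \<in> lit_cliques B" "l \<in> K" using leaf_in_lit_clique[OF l] by blast
    then have "leaf_label A (snd (atom (target l))) (map_literal fst (target l))"
      using cov lit_cliques_address_form(2) by (fastforce simp: covers_def)
    moreover have "map_literal fst (target l) = map_literal g l"
    proof -
      have "atom l \<in> set_form B"
        using leaf_label_set_form[of B v l "atom l" "[]" B] l by (cases l) auto
      then show ?thesis
        using cov by (cases l rule: target.cases) (auto simp: covers_def g_def)
    qed
    ultimately show ?thesis using label_at_eq[OF l] by (simp add: f_def)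
  qed
  have label': "\<exists>l. leaf_label B v l \<and> l' = map_literal g l" if v: "leaf_label ?A' v l'" for v l'
  proof -
    obtain C where "subform_at B v = Some C" "map_form g C = Lit l'"
      using v by (auto simp: leaf_label_def subform_at_map)
    then show ?thesis by (cases C) (auto simp: leaf_label_def)
  qed
  have "f \<in> leaves ?A' \<rightarrow> leaves A"
    using label label' by (fastforce simp: leaves_def)
  moreover have "label_preserving ?A' A f"
  proof -
    have "leaf_label ?A' v l \<longleftrightarrow> leaf_label A (f v) l" if v: "v \<in> leaves ?A'" for v l
    proof -
      obtain l' where l': "leaf_label ?A' v l'" using v by (auto simp: leaves_def)
      then have "leaf_label A (f v) l'" using label label' by blast
      then show ?thesis using l' by (auto simp: leaf_label_def)
    qed
    then show ?thesis by (simp add: label_preserving_def)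
  qed
  moreover have "clique_preserving ?A' A f"
  proof -
    have "f ` K \<in> res_cliques A" if "K \<in> res_cliques B" for K
    proof -
      have "target ` label_at B ` K \<in> lit_cliques (address_form A)"
        using label_at_image_lit_clique[OF that] cov by (simp add: covers_def)
      from lit_cliques_address_form(1)[OF this] show ?thesis
        by (simp add: image_image f_def)
    qed
    moreover have "res_cliques ?A' = res_cliques B" by (induction B) auto
    ultimately show ?thesis by (simp add: clique_preserving_def clique_iff_res_cliques)
  qed
  ultimately show ?thesis
    using mll_proof_net_map[OF B, of g] unfolding combinatorial_proof_def by blast
qed

theorem mainTheorem1:
  fixes A :: "'v form"
  shows "valid A \<longleftrightarrow> (\<exists>A' \<Lambda> f. combinatorial_proof A A' \<Lambda> f)"
  using valid_imp_combinatorial_proof combinatorial_proof_imp_valid by blast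

end
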